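(* Let $U$ be an open subset of $\mathbb{R}^d$ and let $\mathbf{L}_1,\ldots,\mathbf{L}_r$ be $m\times n$ matrices of linear partial differential operators with coefficients from $\mathcal{C}(U)$. Then the following are equivalent: (1) For every $\boldsymbol{\phi}\in\mathcal{C}^{(\infty)}_c(U)^n$, the elements $\mathbf{L}_1\boldsymbol{\phi},\ldots,\mathbf{L}_r\boldsymbol{\phi}$ of $\mathcal{C}(U)^m$ are linearly dependent (over $\mathbb{R}$). (2) $\mathbf{L}_1,\ldots,\mathbf{L}_r$ are linearly dependent (over $\mathbb{R}$).
   Context: $\mathcal{C}(U)$ is the real vector space of all continuous real functions on $U$, and $\mathcal{C}^{(\infty)}_c(U)$ is the real vector space of all infinitely differentiable real functions with compact support on $U$. An $m\times n$ matrix of linear partial differential operators with coefficients from $\mathcal{C}(U)$ can be written as a finite sum $\mathbf{L}=\sum_{\alpha\in\mathbb{N}_0^d,\,|\alpha|\le s}\mathbf{P}_\alpha D^\alpha$ for some $s\in\mathbb{N}_0$, where $\mathbf{P}_\alpha\in\mathcal{C}(U)^{m\times n}$ and $D^\alpha=\frac{\partial^{|\alpha|}}{(\partial x_1)^{\alpha_1}\cdots(\partial x_d)^{\alpha_d}}$; it acts on column vectors $\boldsymbol{\phi}=[\phi_1,\ldots,\phi_n]^T$ by $\mathbf{L}\boldsymbol{\phi}=\sum_\alpha\mathbf{P}_\alpha D^\alpha\boldsymbol{\phi}$, with $D^\alpha$ applied entrywise. A finite list $v_1,\ldots,v_r$ ($r\ge1$) in a real vector space is linearly dependent if there are real constants $c_1,\ldots,c_r$,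 not all zero, with $\sum_i c_iv_i=0$; for matrices of operators, $\sum_i c_i\mathbf{L}_i=0$ means that all its coefficient matrices vanish identically on $U$. *)

theory Defs
  imports "HOL-Analysis.Analysis"
begin

text \<open>
  Coordinates of \<open>\<real>\<^sup>d\<close> are indexed by a finite linearly ordered type \<open>'d\<close> (such as a numeral
  type, which gives every \<open>d \<ge> 1\<close>). The order only serves to fix the sequence in which the partial
  derivatives making up \<open>D\<^sup>\<alpha>\<close> are taken. Functions on an open set \<open>U\<close> are represented by total
  functions of which only the values on \<open>U\<close> matter.
\<close>

definition partial_deriv :: "'d::finite \<Rightarrow> (real ^ 'd \<Rightarrow> real) \<Rightarrow> real ^ 'd \<Rightarrow> real" where
  "partial_deriv i f x = deriv (\<lambda>t. f (x + t *\<^sub>R axis i 1)) 0"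

definition has_partial_deriv_at :: "'d::finite \<Rightarrow> (real ^ 'd \<Rightarrow> real) \<Rightarrow> real ^ 'd \<Rightarrow> bool" where
  "has_partial_deriv_at i f x \<longleftrightarrow> (\<lambda>t. f (x + t *\<^sub>R axis i 1)) field_differentiable (at 0)"

primrec C_k_on :: "nat \<Rightarrow> (real ^ 'd::finite) set \<Rightarrow> (real ^ 'd \<Rightarrow> real) \<Rightarrow> bool" where
  "C_k_on 0 U f \<longleftrightarrow> continuous_on U f"
| "C_k_on (Suc k) U f \<longleftrightarrow> continuous_on U f \<and>
     (\<forall>i. (\<forall>x\<in>U. has_partial_deriv_at i f x) \<and> C_k_on k U (partial_deriv i f))"

definition smooth_on :: "(real ^ 'd::finite) set \<Rightarrow> (real ^ 'd \<Rightarrow> real) \<Rightarrow> bool" where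
  "smooth_on U f \<longleftrightarrow> (\<forall>k. C_k_on k U f)"

text \<open>
  Smooth functions with compact support in \<open>U\<close>, extended by zero outside \<open>U\<close>: the inclusion of the
  support in \<open>U\<close> forces the function to vanish off \<open>U\<close>.
\<close>

definition Cc_infinity :: "(real ^ 'd::finite) set \<Rightarrow> (real ^ 'd \<Rightarrow> real) set" where
  "Cc_infinity U = {f. smooth_on U f \<and> compact (closure {x. f x \<noteq> 0}) \<and> closure {x. f x \<noteq> 0} \<subseteq> U}"

definition mi_order :: "nat ^ 'd::finite \<Rightarrow> nat" where
  "mi_order \<alpha> = (\<Sum>i\<in>UNIV. \<alpha> $ i)"

definition mi_deriv ::
    "nat ^ 'd::{finite,linorder} \<Rightarrow> (real ^ 'd::{finite,linorder} \<Rightarrow> real) \<Rightarrow>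
      real ^ 'd::{finite,linorder} \<Rightarrow> real" where
  "mi_deriv \<alpha> f = foldr (\<lambda>i. partial_deriv i ^^ (\<alpha> $ i)) (sorted_list_of_set UNIV) f"

text \<open>
  A matrix of partial differential operators \<open>\<Sum>\<^sub>\<alpha> P\<^sub>\<alpha> D\<^sup>\<alpha>\<close> is represented by its family of
  coefficient matrices \<open>\<alpha> \<mapsto> P\<^sub>\<alpha>\<close>.
\<close>

type_synonym ('d, 'n, 'm) pdo = "nat ^ 'd \<Rightarrow> real ^ 'd \<Rightarrow> real ^ 'n ^ 'm"

definition is_pdo_on :: "(real ^ 'd::finite) set \<Rightarrow> ('d, 'n::finite, 'm::finite) pdo \<Rightarrow> bool" where
  "is_pdo_on U P \<longleftrightarrow> (\<forall>\<alpha>. continuous_on U (P \<alpha>)) \<and>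
     (\<exists>s. \<forall>\<alpha>. s < mi_order \<alpha> \<longrightarrow> (\<forall>x\<in>U. P \<alpha> x = 0))"

text \<open>
  Terms with vanishing coefficient are left out of the sum, so that the index set is finite at every
  point of \<open>U\<close>; lemma \<open>pdo_apply_eq\<close> below recovers the sum over all \<open>\<alpha>\<close> with \<open>|\<alpha>| \<le> s\<close>.
\<close>

definition pdo_apply :: "('d::{finite,linorder}, 'n::finite, 'm::finite) pdo \<Rightarrow>
    (real ^ 'd::{finite,linorder} \<Rightarrow> real ^ 'n) \<Rightarrow> real ^ 'd::{finite,linorder} \<Rightarrow> real ^ 'm" where
  "pdo_apply P \<phi> x =
     (\<Sum>\<alpha> | P \<alpha> x \<noteq> 0. P \<alpha> x *v (\<chi> j. mi_deriv \<alpha> (\<lambda>y. \<phi> y $ j) x))"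

text \<open>Linear dependence of lists of length \<open>r\<close>, as elements of \<open>C(U)\<^sup>m\<close> and as operators on \<open>U\<close>.\<close>

definition lin_dep_functions_on ::
    "(real ^ 'd::finite) set \<Rightarrow> nat \<Rightarrow> (nat \<Rightarrow> real ^ 'd \<Rightarrow> real ^ 'm::finite) \<Rightarrow> bool" where
  "lin_dep_functions_on U r v \<longleftrightarrow>
     (\<exists>c :: nat \<Rightarrow> real. (\<exists>i<r. c i \<noteq> 0) \<and> (\<forall>x\<in>U. (\<Sum>i<r. c i *\<^sub>R v i x) = 0))"

definition lin_dep_pdos_on ::
    "(real ^ 'd::finite) set \<Rightarrow> nat \<Rightarrow> (nat \<Rightarrow> ('d, 'n::finite, 'm::finite) pdo) \<Rightarrow> bool" where
  "lin_dep_pdos_on U r L \<longleftrightarrow>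
     (\<exists>c :: nat \<Rightarrow> real. (\<exists>i<r. c i \<noteq> 0) \<and> (\<forall>\<alpha>. \<forall>x\<in>U. (\<Sum>i<r. c i *\<^sub>R L i \<alpha> x) = 0))"

lemma finite_mi_order_le: "finite {\<alpha> :: nat ^ 'd::finite. mi_order \<alpha> \<le> s}"
proof (rule finite_subset)
  show "{\<alpha> :: nat ^ 'd. mi_order \<alpha> \<le> s} \<subseteq> vec_lambda ` (PiE UNIV (\<lambda>_. {..s}))"
  proof
    fix \<alpha> :: "nat ^ 'd"
    assume "\<alpha> \<in> {\<alpha>. mi_order \<alpha> \<le> s}"
    then have le: "(\<Sum>i\<in>UNIV. \<alpha> $ i) \<le> s"
      by (simp add: mi_order_def)
    have "\<alpha> $ i \<le> s" for i
      using member_le_sum[of i UNIV "\<lambda>i. \<alpha> $ i"] le by simp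
    then have "vec_nth \<alpha> \<in> PiE UNIV (\<lambda>_. {..s})"
      by (auto simp: PiE_def)
    then show "\<alpha> \<in> vec_lambda ` (PiE UNIV (\<lambda>_. {..s}))"
      by (metis image_eqI vec_nth_inverse)
  qed
  show "finite (vec_lambda ` (PiE (UNIV :: 'd set) (\<lambda>_. {..s})))"
    by (intro finite_imageI finite_PiE) auto
qed

lemma pdo_apply_eq:
  fixes P :: "('d::{finite,linorder}, 'n::finite, 'm::finite) pdo"
  assumes "\<And>\<alpha>. s < mi_order \<alpha> \<Longrightarrow> P \<alpha> x = 0"
  shows "pdo_apply P \<phi> x =
    (\<Sum>\<alpha> | mi_order \<alpha> \<le> s. P \<alpha> x *v (\<chi> j. mi_deriv \<alpha> (\<lambda>y. \<phi> y $ j) x))"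
  unfolding pdo_apply_def
proof (rule sum.mono_neutral_left)
  show "{\<alpha>. P \<alpha> x \<noteq> 0} \<subseteq> {\<alpha>. mi_order \<alpha> \<le> s}"
    using assms not_le by blast
qed (auto simp: finite_mi_order_le)

end

theory Submission
  imports Defs
begin

text \<open>
  A vanishing combination of the operators gives the same vanishing combination of the functions
  \<open>L\<^sub>i \<phi>\<close>, for every \<open>\<phi>\<close>. The content is the converse: for independent \<open>L\<^sub>1, \<dots>, L\<^sub>r\<close> a single test
  function \<open>\<phi>\<close> must make \<open>L\<^sub>1 \<phi>, \<dots>, L\<^sub>r \<phi>\<close> independent. The proof finds \<open>\<phi>\<close> together with a finite
  set \<open>S \<subseteq> U\<close> such that the values of the \<open>L\<^sub>i \<phi>\<close> on \<open>S\<close> alone are already independent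
  (\<open>ex_separating_test_function\<close>), by induction on \<open>r\<close>.

  Let \<open>\<phi>\<close> and \<open>S\<close> serve for the first \<open>r\<close> operators, and suppose that they fail for \<open>r + 1\<close>. Then
  some nontrivial \<open>M = \<Sum>\<^sub>i c\<^sub>i L\<^sub>i\<close> has \<open>M \<phi> = 0\<close> on \<open>S\<close>, and \<open>c\<close> is the only such vector up to
  scaling, because the first \<open>r\<close> operators admit none.
  Since \<open>M\<close> is not the zero operator and its coefficients are continuous, one of them is nonzero on a
  nonempty open set, hence at some point \<open>y\<close> outside the finite set \<open>S\<close>. Unless \<open>M \<phi> y \<noteq> 0\<close>
  already, adding to \<open>\<phi>\<close> a test function with support away from \<open>S\<close> achieves this and changes
  nothing on \<open>S\<close>
  (\<open>ex_test_function_detecting_combination\<close>). Now the new values on \<open>S \<union> {y}\<close> are independent: those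
  on \<open>S\<close> allow only multiples of \<open>c\<close>, and the value at \<open>y\<close> excludes these (\<open>separates_at_insert\<close>).

  The local test function comes from \<open>ex_smooth_with_leading_derivative\<close>: if \<open>\<alpha>\<close> has maximal order
  among the nonzero coefficients of \<open>M\<close> at \<open>y\<close>, it suffices that \<open>D\<^sup>\<alpha> f\<close> is nonzero at \<open>y\<close> while all
  other derivatives of at most the same order vanish there. The function
  \<open>\<Prod>\<^sub>i (x\<^sub>i - y\<^sub>i)\<^bsup>\<alpha>\<^sub>i\<^esup> b (x\<^sub>i - y\<^sub>i)\<close> with a one-dimensional bump \<open>b\<close> does this. Because it is a product of
  functions of single coordinates, its smoothness and its derivatives reduce to one variable.
\<close>

section \<open>Smooth functions of one variable\<close>

text \<open>
  Counting derivatives by recursion makes closure under products and compositions a plain induction: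
  the derivative of a product is a sum of products of functions with one derivative less to give.
\<close>

primrec times_differentiable :: "nat \<Rightarrow> (real \<Rightarrow> real) \<Rightarrow> bool" where
  "times_differentiable 0 f \<longleftrightarrow> True"
| "times_differentiable (Suc k) f \<longleftrightarrow>
     (\<forall>x. f field_differentiable at x) \<and> times_differentiable k (deriv f)"

definition smooth_real :: "(real \<Rightarrow> real) \<Rightarrow> bool" where
  "smooth_real f \<longleftrightarrow> (\<forall>k. times_differentiable k f)"

lemma times_differentiable_SucI:
  assumes "\<And>x. (f has_real_derivative f' x) (at x)" "times_differentiable k f'"
  shows "times_differentiable (Suc k) f"
proof -
  have "deriv f = f'"
    using assms(1) DERIV_imp_deriv by blast
  then show ?thesis
    using assms by (auto simp: field_differentiable_def)
qed

lemma times_differentiable_SucD: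
  assumes "times_differentiable (Suc k) f"
  shows "(f has_real_derivative deriv f x) (at x)" "times_differentiable k (deriv f)"
  using assms by (auto simp: field_differentiable_derivI)

lemma times_differentiable_pred: "times_differentiable (Suc k) f \<Longrightarrow> times_differentiable k f"
  by (induction k arbitrary: f) auto

lemma times_differentiable_const: "times_differentiable k (\<lambda>_. c)"
proof (induction k arbitrary: c)
  case (Suc k)
  show ?case
    by (rule times_differentiable_SucI[where f' = "\<lambda>_. 0"]) (auto intro: Suc)
qed simp

lemma times_differentiable_affine: "times_differentiable k (\<lambda>t. a * t + b)"
proof (cases k)
  case (Suc k')
  show ?thesis
    unfolding Suc
    by (rule times_differentiable_SucI[where f' = "\<lambda>_. a"])
      (auto intro!: derivative_eq_intros times_differentiable_const)
qed simp

lemma times_differentiable_add: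
  "times_differentiable k f \<Longrightarrow> times_differentiable k g \<Longrightarrow>
    times_differentiable k (\<lambda>t. f t + g t)"
proof (induction k arbitrary: f g)
  case (Suc k)
  have "((\<lambda>t. f t + g t) has_real_derivative (deriv f x + deriv g x)) (at x)" for x
    by (intro DERIV_add times_differentiable_SucD(1)[OF Suc.prems(1)]
        times_differentiable_SucD(1)[OF Suc.prems(2)])
  moreover have "times_differentiable k (\<lambda>x. deriv f x + deriv g x)"
    using Suc by auto
  ultimately show ?case
    by (rule times_differentiable_SucI)
qed simp

lemma times_differentiable_mult:
  "times_differentiable k f \<Longrightarrow> times_differentiable k g \<Longrightarrow>
    times_differentiable k (\<lambda>t. f t * g t)"
proof (induction k arbitrary: f g)
  case (Suc k)
  have "((\<lambda>t. f t * g t) has_real_derivative (deriv f x * g x + deriv g x * f x)) (at x)" for x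
    by (intro DERIV_mult times_differentiable_SucD(1)[OF Suc.prems(1)]
        times_differentiable_SucD(1)[OF Suc.prems(2)])
  moreover have "times_differentiable k (\<lambda>x. deriv f x * g x + deriv g x * f x)"
    using Suc.prems Suc.prems[THEN times_differentiable_pred]
    by (intro times_differentiable_add Suc.IH) auto
  ultimately show ?case
    by (rule times_differentiable_SucI)
qed simp

lemma times_differentiable_compose:
  "times_differentiable k f \<Longrightarrow> times_differentiable k g \<Longrightarrow>
    times_differentiable k (\<lambda>t. f (g t))"
proof (induction k arbitrary: f)
  case (Suc k)
  have "((\<lambda>t. f (g t)) has_real_derivative (deriv f (g x) * deriv g x)) (at x)" for x
    by (rule DERIV_chain2[OF times_differentiable_SucD(1)[OF Suc.prems(1)]
          times_differentiable_SucD(1)[OF Suc.prems(2)]])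
  moreover have "times_differentiable k (\<lambda>x. deriv f (g x) * deriv g x)"
    using Suc.prems Suc.prems[THEN times_differentiable_pred]
    by (intro times_differentiable_mult Suc.IH[of "deriv f"]) simp_all
  ultimately show ?case
    by (rule times_differentiable_SucI)
qed simp

lemma smooth_real_id: "smooth_real (\<lambda>t. t)"
  using times_differentiable_affine[of _ 1 0] by (simp add: smooth_real_def)

lemma smooth_real_const: "smooth_real (\<lambda>_. c)"
  by (simp add: smooth_real_def times_differentiable_const)

lemma smooth_real_affine: "smooth_real (\<lambda>t. a * t + b)"
  by (simp add: smooth_real_def times_differentiable_affine)

lemma smooth_real_add: "smooth_real f \<Longrightarrow> smooth_real g \<Longrightarrow> smooth_real (\<lambda>t. f t + g t)"
  by (simp add: smooth_real_def times_differentiable_add)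

lemma smooth_real_mult: "smooth_real f \<Longrightarrow> smooth_real g \<Longrightarrow> smooth_real (\<lambda>t. f t * g t)"
  by (simp add: smooth_real_def times_differentiable_mult)

lemma smooth_real_compose: "smooth_real f \<Longrightarrow> smooth_real g \<Longrightarrow> smooth_real (\<lambda>t. f (g t))"
  by (simp add: smooth_real_def times_differentiable_compose)

lemma smooth_real_power: "smooth_real f \<Longrightarrow> smooth_real (\<lambda>t. f t ^ k)"
  by (induction k) (auto intro: smooth_real_const smooth_real_mult)

lemma smooth_real_deriv: "smooth_real f \<Longrightarrow> smooth_real (deriv f)"
  unfolding smooth_real_def using times_differentiable_SucD(2) by blast

lemma smooth_real_DERIV: "smooth_real f \<Longrightarrow> (f has_real_derivative deriv f x) (at x)"
  unfolding smooth_real_def using times_differentiable_SucD(1) by blast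

lemma smooth_real_funpow_deriv: "smooth_real f \<Longrightarrow> smooth_real ((deriv ^^ k) f)"
  by (induction k) (auto intro: smooth_real_deriv)

text \<open>
  The classical flat function \<open>exp (- 1 / t)\<close> is \<open>flat_exp 0\<close>. The extra factor \<open>(1 / t)\<^sup>n\<close> makes the
  linear span of the family closed under differentiation.
\<close>

definition flat_exp :: "nat \<Rightarrow> real \<Rightarrow> real" where
  "flat_exp n t = (if t \<le> 0 then 0 else (1 / t) ^ n * exp (- (1 / t)))"

lemma flat_exp_tendsto_0: "(flat_exp n \<longlongrightarrow> 0) (at 0)"
proof -
  have "((\<lambda>t. (inverse t) ^ n / exp (inverse t)) \<longlongrightarrow> (0::real)) (at_right 0)"
    using filterlim_compose[OF tendsto_power_div_exp_0 filterlim_inverse_at_top_right] .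
  moreover have "\<forall>\<^sub>F t in at_right 0. (inverse t) ^ n / exp (inverse t) = flat_exp n t"
    unfolding eventually_at_filter
    by (auto simp: flat_exp_def exp_minus field_simps inverse_eq_divide)
  ultimately have right: "(flat_exp n \<longlongrightarrow> 0) (at_right 0)"
    by (rule Lim_transform_eventually)
  have "\<forall>\<^sub>F t in at_left 0. 0 = flat_exp n t"
    unfolding eventually_at_filter by (auto simp: flat_exp_def)
  then have "(flat_exp n \<longlongrightarrow> 0) (at_left 0)"
    by (rule Lim_transform_eventually[OF tendsto_const])
  with right show ?thesis
    by (simp add: filterlim_split_at)
qed

text \<open>
  At the origin the difference quotient of \<open>flat_exp n\<close> is \<open>flat_exp (n + 1)\<close>, which tends to \<open>0\<close>.
\<close>

lemma flat_exp_DERIV: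
  "(flat_exp n has_real_derivative (flat_exp (n + 2) t + (- real n) * flat_exp (n + 1) t)) (at t)"
proof (cases t "0::real" rule: linorder_cases)
  case less
  have "((\<lambda>_. 0) has_real_derivative 0) (at t)"
    by simp
  moreover have "\<forall>\<^sub>F s in nhds t. flat_exp n s = 0"
    using less eventually_nhds_in_open[of "{..<0}" t]
    by (auto simp: flat_exp_def elim!: eventually_mono)
  ultimately show ?thesis
    using less by (subst DERIV_cong_ev[where g = "\<lambda>_. 0"]) (auto simp: flat_exp_def)
next
  case equal
  have "(\<lambda>h. (flat_exp n (0 + h) - flat_exp n 0) / h) = flat_exp (n + 1)"
    by (auto simp: flat_exp_def fun_eq_iff)
  then show ?thesis
    using flat_exp_tendsto_0[of "n + 1"] equal by (simp add: DERIV_def flat_exp_def)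
next
  case greater
  have "((\<lambda>t. (1 / t) ^ n * exp (- (1 / t))) has_real_derivative
      (flat_exp (n + 2) t + (- real n) * flat_exp (n + 1) t)) (at t)"
    using greater
    by (cases n; auto intro!: derivative_eq_intros simp: flat_exp_def)
      (auto simp: field_simps power_add power2_eq_square, metis One_nat_def power_eq_if)
  moreover have "\<forall>\<^sub>F s in nhds t. flat_exp n s = (1 / s) ^ n * exp (- (1 / s))"
    using greater eventually_nhds_in_open[of "{0<..}" t]
    by (auto simp: flat_exp_def elim!: eventually_mono)
  ultimately show ?thesis
    by (subst DERIV_cong_ev[OF refl _ refl]) auto
qed

lemma smooth_real_flat_exp: "smooth_real (flat_exp n)"
  unfolding smooth_real_def
proof
  fix k
  show "times_differentiable k (flat_exp n)"
  proof (induction k arbitrary: n)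
    case (Suc k)
    show ?case
      by (rule times_differentiable_SucI[OF flat_exp_DERIV])
        (intro times_differentiable_add times_differentiable_mult times_differentiable_const Suc)
  qed simp
qed

lemma ex_bump:
  assumes "\<delta> > 0"
  obtains b where "smooth_real b" "b 0 \<noteq> 0" "\<And>t. \<delta> < \<bar>t\<bar> \<Longrightarrow> b t = 0"
proof
  let ?b = "\<lambda>t. flat_exp 0 (1 * t + \<delta>) * flat_exp 0 ((-1) * t + \<delta>)"
  show "smooth_real ?b"
    by (intro smooth_real_mult smooth_real_compose[OF smooth_real_flat_exp] smooth_real_affine)
  show "?b 0 \<noteq> 0"
    using assms by (simp add: flat_exp_def)
  show "?b t = 0" if "\<delta> < \<bar>t\<bar>" for t
    using that by (auto simp: flat_exp_def)
qed

text \<open>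
  The derivative of \<open>t\<^bsup>k + 1\<^esup> b t\<close> is \<open>t\<^sup>k\<close> times \<open>(k + 1) b t + t b' t\<close>, a factor which is again smooth
  and nonzero at \<open>0\<close>. So each differentiation lowers the order of the zero by exactly one, and the
  induction is over all \<open>b\<close> at once.
\<close>

lemma funpow_deriv_monomial_times:
  assumes "smooth_real b" "b 0 \<noteq> 0"
  shows "j < k \<Longrightarrow> (deriv ^^ j) (\<lambda>t. t ^ k * b t) 0 = 0"
    and "(deriv ^^ k) (\<lambda>t. t ^ k * b t) 0 \<noteq> 0"
proof -
  have "(\<forall>j<k. (deriv ^^ j) (\<lambda>t. t ^ k * b t) 0 = 0) \<and> (deriv ^^ k) (\<lambda>t. t ^ k * b t) 0 \<noteq> 0"
    using assms
  proof (induction k arbitrary: b)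
    case (Suc k)
    let ?b = "\<lambda>t. real (Suc k) * b t + t * deriv b t"
    have "((\<lambda>t. t ^ Suc k * b t) has_real_derivative t ^ k * ?b t) (at t)" for t
      by (rule derivative_eq_intros refl smooth_real_DERIV Suc.prems)+
        (simp add: algebra_simps)
    then have *: "deriv (\<lambda>t. t ^ Suc k * b t) = (\<lambda>t. t ^ k * ?b t)"
      using DERIV_imp_deriv by blast
    have "smooth_real ?b"
      using Suc.prems
      by (intro smooth_real_add smooth_real_mult smooth_real_const smooth_real_id smooth_real_deriv)
    then have IH: "\<forall>j<k. (deriv ^^ j) (\<lambda>t. t ^ k * ?b t) 0 = 0"
        "(deriv ^^ k) (\<lambda>t. t ^ k * ?b t) 0 \<noteq> 0"
      using Suc.IH[of ?b] Suc.prems by auto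
    have "(deriv ^^ Suc j) (\<lambda>t. t ^ Suc k * b t) = (deriv ^^ j) (\<lambda>t. t ^ k * ?b t)" for j
      unfolding funpow_Suc_right comp_def * ..
    then show ?case
      using IH by (auto simp: less_Suc_eq_0_disj simp del: funpow.simps power_Suc)
  qed simp
  then show "j < k \<Longrightarrow> (deriv ^^ j) (\<lambda>t. t ^ k * b t) 0 = 0"
    and "(deriv ^^ k) (\<lambda>t. t ^ k * b t) 0 \<noteq> 0"
    by blast+
qed

section \<open>Locality and additivity of partial derivatives\<close>

lemma eventually_eq_on_line:
  fixes x v :: "'a::real_normed_vector"
  assumes "open U" "x \<in> U" "\<And>x. x \<in> U \<Longrightarrow> f x = g x"
  shows "\<forall>\<^sub>F t in nhds 0. f (x + t *\<^sub>R v) = g (x + t *\<^sub>R v)"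
proof -
  have "((\<lambda>t. x + t *\<^sub>R v) \<longlongrightarrow> x + 0 *\<^sub>R v) (nhds 0)"
    by (intro tendsto_intros filterlim_ident)
  then have "\<forall>\<^sub>F t in nhds 0. x + t *\<^sub>R v \<in> U"
    using assms(1,2) by (auto simp: tendsto_def)
  then show ?thesis
    by (rule eventually_mono) (rule assms(3))
qed

lemma partial_deriv_cong:
  assumes "open U" "x \<in> U" "\<And>x. x \<in> U \<Longrightarrow> f x = g x"
  shows "partial_deriv i f x = partial_deriv i g x"
  unfolding partial_deriv_def
  by (intro deriv_cong_ev refl eventually_eq_on_line[OF assms])

lemma has_partial_deriv_at_cong:
  assumes "open U" "x \<in> U" "\<And>x. x \<in> U \<Longrightarrow> f x = g x"
  shows "has_partial_deriv_at i f x \<longleftrightarrow> has_partial_deriv_at i g x"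
  unfolding has_partial_deriv_at_def field_differentiable_def
  by (intro ex_cong1 DERIV_cong_ev refl eventually_eq_on_line[OF assms])

lemma C_k_on_cong:
  assumes "open U" "\<And>x. x \<in> U \<Longrightarrow> f x = g x"
  shows "C_k_on k U f \<longleftrightarrow> C_k_on k U g"
  using assms(2)
proof (induction k arbitrary: f g)
  case 0
  then show ?case by (simp cong: continuous_on_cong)
next
  case (Suc k)
  have "C_k_on k U (partial_deriv i f) \<longleftrightarrow> C_k_on k U (partial_deriv i g)" for i
    by (rule Suc.IH) (rule partial_deriv_cong[OF assms(1) _ Suc.prems])
  moreover have "continuous_on U f \<longleftrightarrow> continuous_on U g"
    using Suc.prems by (intro continuous_on_cong) auto
  moreover have "\<forall>x\<in>U. has_partial_deriv_at i f x \<longleftrightarrow> has_partial_deriv_at i g x" for i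
    using has_partial_deriv_at_cong[of U _ f g] assms(1) Suc.prems by blast
  ultimately show ?case by auto
qed

lemma C_k_on_subset: "C_k_on k U f \<Longrightarrow> V \<subseteq> U \<Longrightarrow> C_k_on k V f"
  by (induction k arbitrary: f) (auto intro: continuous_on_subset)

lemma smooth_on_subset: "smooth_on U f \<Longrightarrow> V \<subseteq> U \<Longrightarrow> smooth_on V f"
  unfolding smooth_on_def using C_k_on_subset by blast

lemma smooth_on_partial_deriv: "smooth_on U f \<Longrightarrow> smooth_on U (partial_deriv i f)"
  unfolding smooth_on_def using C_k_on.simps(2) by blast

lemma smooth_on_has_partial_deriv: "smooth_on U f \<Longrightarrow> x \<in> U \<Longrightarrow> has_partial_deriv_at i f x"
  unfolding smooth_on_def using C_k_on.simps(2) by blast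

lemma partial_deriv_add:
  assumes "has_partial_deriv_at i f x" "has_partial_deriv_at i g x"
  shows "partial_deriv i (\<lambda>x. f x + g x) x = partial_deriv i f x + partial_deriv i g x"
    and "has_partial_deriv_at i (\<lambda>x. f x + g x) x"
  using assms unfolding has_partial_deriv_at_def partial_deriv_def
  by (auto intro: field_differentiable_add)

lemma C_k_on_add:
  assumes "open U"
  shows "C_k_on k U f \<Longrightarrow> C_k_on k U g \<Longrightarrow> C_k_on k U (\<lambda>x. f x + g x)"
proof (induction k arbitrary: f g)
  case 0
  then show ?case by (simp add: continuous_on_add)
next
  case (Suc k)
  have "C_k_on k U (\<lambda>x. partial_deriv i f x + partial_deriv i g x)" for i
    using Suc by auto
  then have "C_k_on k U (partial_deriv i (\<lambda>x. f x + g x))" for i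
    using Suc.prems by (subst C_k_on_cong[OF assms partial_deriv_add(1)]) auto
  then show ?case
    using Suc.prems by (auto intro: continuous_on_add partial_deriv_add)
qed

lemma smooth_on_add: "open U \<Longrightarrow> smooth_on U f \<Longrightarrow> smooth_on U g \<Longrightarrow> smooth_on U (\<lambda>x. f x + g x)"
  unfolding smooth_on_def using C_k_on_add by blast

lemma partial_deriv_zero: "partial_deriv i (\<lambda>_. 0) = (\<lambda>_. 0)"
  by (simp add: partial_deriv_def fun_eq_iff)

lemma smooth_on_zero: "smooth_on U (\<lambda>_. 0)"
proof -
  have "C_k_on k U (\<lambda>_. 0)" for k
    by (induction k) (auto simp: partial_deriv_zero has_partial_deriv_at_def)
  then show ?thesis by (simp add: smooth_on_def)
qed

text \<open>
  The features of \<open>D\<^sup>\<alpha>\<close> on which the proof relies. They are bundled into one predicate because they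
  depend on each other under composition: additivity of \<open>T \<circ> T'\<close> on \<open>U\<close> requires that \<open>T'\<close> preserves
  smoothness, and that \<open>T\<close> sees only values on \<open>U\<close>, since \<open>T'\<close> is additive only there.
\<close>

definition local_additive_on ::
    "(real ^ 'd::finite) set \<Rightarrow> ((real ^ 'd \<Rightarrow> real) \<Rightarrow> real ^ 'd \<Rightarrow> real) \<Rightarrow> bool" where
  "local_additive_on U T \<longleftrightarrow> (\<forall>f. smooth_on U f \<longrightarrow> smooth_on U (T f)) \<and>
     (\<forall>f g. (\<forall>x\<in>U. f x = g x) \<longrightarrow> (\<forall>x\<in>U. T f x = T g x)) \<and>
     (\<forall>f g. smooth_on U f \<longrightarrow> smooth_on U g \<longrightarrow> (\<forall>x\<in>U. T (\<lambda>x. f x + g x) x = T f x + T g x)) \<and>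
     T (\<lambda>_. 0) = (\<lambda>_. 0)"

lemma local_additive_onD:
  assumes "local_additive_on U T"
  shows "smooth_on U f \<Longrightarrow> smooth_on U (T f)"
    and "(\<And>x. x \<in> U \<Longrightarrow> f x = g x) \<Longrightarrow> x \<in> U \<Longrightarrow> T f x = T g x"
    and "smooth_on U f \<Longrightarrow> smooth_on U g \<Longrightarrow> x \<in> U \<Longrightarrow> T (\<lambda>x. f x + g x) x = T f x + T g x"
    and "T (\<lambda>_. 0) = (\<lambda>_. 0)"
  using assms unfolding local_additive_on_def by simp_all

lemma local_additive_on_partial_deriv:
  assumes "open U"
  shows "local_additive_on U (partial_deriv i)"
  unfolding local_additive_on_def
proof (intro conjI allI impI ballI)
  fix f g :: "real ^ 'a \<Rightarrow> real" and x
  assume "x \<in> U"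
  show "partial_deriv i f x = partial_deriv i g x" if "\<forall>x\<in>U. f x = g x"
    by (rule partial_deriv_cong[OF assms \<open>x \<in> U\<close>]) (use that in blast)
  show "partial_deriv i (\<lambda>x. f x + g x) x = partial_deriv i f x + partial_deriv i g x"
    if "smooth_on U f" "smooth_on U g"
    using that by (intro partial_deriv_add(1) smooth_on_has_partial_deriv[OF _ \<open>x \<in> U\<close>])
qed (simp_all add: smooth_on_partial_deriv partial_deriv_zero)

lemma local_additive_on_id: "local_additive_on U (\<lambda>f. f)"
  by (simp add: local_additive_on_def)

lemma local_additive_on_compose:
  assumes T: "local_additive_on U T" and T': "local_additive_on U T'"
  shows "local_additive_on U (\<lambda>f. T (T' f))"
  unfolding local_additive_on_def
proof (intro conjI allI impI ballI)
  fix f g :: "real ^ 'a \<Rightarrow> real" and x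
  assume "x \<in> U"
  show "T (T' f) x = T (T' g) x" if "\<forall>x\<in>U. f x = g x"
    using that by (intro local_additive_onD(2)[OF T] local_additive_onD(2)[OF T'] \<open>x \<in> U\<close>) simp_all
  show "T (T' (\<lambda>x. f x + g x)) x = T (T' f) x + T (T' g) x"
    if fg: "smooth_on U f" "smooth_on U g"
  proof -
    have "T (T' (\<lambda>x. f x + g x)) x = T (\<lambda>x. T' f x + T' g x) x"
      by (rule local_additive_onD(2)[OF T _ \<open>x \<in> U\<close>]) (rule local_additive_onD(3)[OF T' fg])
    also have "\<dots> = T (T' f) x + T (T' g) x"
      using fg by (intro local_additive_onD(3)[OF T] local_additive_onD(1)[OF T'] \<open>x \<in> U\<close>)
    finally show ?thesis .
  qed
qed (simp_all add: local_additive_onD(1)[OF T] local_additive_onD(1)[OF T']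
    local_additive_onD(4)[OF T] local_additive_onD(4)[OF T'])

lemma local_additive_on_mi_deriv:
  assumes "open U"
  shows "local_additive_on U (mi_deriv \<alpha>)"
proof -
  have pow: "local_additive_on U (partial_deriv i ^^ n)" for i n
  proof (induction n)
    case (Suc n)
    from local_additive_on_compose[OF local_additive_on_partial_deriv[OF assms] this]
    show ?case by (simp add: comp_def)
  qed (simp add: local_additive_on_id id_def)
  have "local_additive_on U (foldr (\<lambda>i. partial_deriv i ^^ (\<alpha> $ i)) xs)" for xs
  proof (induction xs)
    case (Cons i xs)
    from local_additive_on_compose[OF pow this]
    show ?case by (simp add: comp_def)
  qed (simp add: local_additive_on_id id_def)
  then show ?thesis
    by (simp add: mi_deriv_def[abs_def])
qed

lemma mi_deriv_zero: "mi_deriv \<alpha> (\<lambda>_. 0) = (\<lambda>_. 0)"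
  by (rule local_additive_onD(4)[OF local_additive_on_mi_deriv[OF open_UNIV]])

lemma mi_deriv_add:
  assumes "open U" "x \<in> U" "smooth_on U f" "smooth_on U g"
  shows "mi_deriv \<alpha> (\<lambda>x. f x + g x) x = mi_deriv \<alpha> f x + mi_deriv \<alpha> g x"
  by (rule local_additive_onD(3)[OF local_additive_on_mi_deriv[OF assms(1)] assms(3,4,2)])

lemma mi_deriv_outside_support:
  assumes "x \<notin> closure {x. f x \<noteq> 0}"
  shows "mi_deriv \<alpha> f x = 0"
proof -
  let ?V = "- closure {x. f x \<noteq> 0}"
  have "open ?V"
    by (intro open_Compl closed_closure)
  have "f y = (\<lambda>_. 0) y" if "y \<in> ?V" for y
    using that closure_subset[of "{x. f x \<noteq> 0}"] by auto
  then have "mi_deriv \<alpha> f x = mi_deriv \<alpha> (\<lambda>_. 0) x"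
    by (rule local_additive_onD(2)[OF local_additive_on_mi_deriv[OF \<open>open ?V\<close>]])
      (use assms in simp_all)
  then show ?thesis by (simp add: mi_deriv_zero)
qed

section \<open>Products of functions of one variable\<close>

definition tensor :: "('d::finite \<Rightarrow> real \<Rightarrow> real) \<Rightarrow> real ^ 'd \<Rightarrow> real" where
  "tensor g x = (\<Prod>j\<in>UNIV. g j (x $ j))"

lemma tensor_partial_deriv:
  assumes "smooth_real (g i)"
  shows "partial_deriv i (tensor g) = tensor (g(i := deriv (g i)))"
    and "has_partial_deriv_at i (tensor g) x"
proof -
  have *: "((\<lambda>t. tensor g (x + t *\<^sub>R axis i 1)) has_real_derivative
      tensor (g(i := deriv (g i))) x) (at 0)" for x
  proof -
    let ?c = "\<Prod>j\<in>UNIV - {i}. g j (x $ j)"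
    have split: "tensor h y = h i (y $ i) * (\<Prod>j\<in>UNIV - {i}. h j (y $ j))" for h y
      unfolding tensor_def by (rule prod.remove) auto
    have eq: "tensor g (x + t *\<^sub>R axis i 1) = g i (x $ i + t) * ?c" for t
      unfolding split by (auto simp: axis_def intro!: prod.cong)
    have eq': "tensor (g(i := deriv (g i))) x = deriv (g i) (x $ i) * ?c"
      unfolding split by (auto intro!: prod.cong)
    have "((\<lambda>t. g i (x $ i + t)) has_real_derivative deriv (g i) (x $ i)) (at 0)"
      using smooth_real_DERIV[OF assms, of "x $ i"] DERIV_shift[of "g i" _ 0 "x $ i"]
      by (simp add: add.commute)
    then show ?thesis
      unfolding eq eq' by (rule DERIV_cmult_right)
  qed
  show "partial_deriv i (tensor g) = tensor (g(i := deriv (g i)))"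
    using DERIV_imp_deriv[OF *] by (simp add: partial_deriv_def fun_eq_iff)
  show "has_partial_deriv_at i (tensor g) x"
    using * by (auto simp: has_partial_deriv_at_def field_differentiable_def)
qed

text \<open>
  By \<open>tensor_partial_deriv\<close> the class of these products is closed under partial differentiation, so
  continuity of its members already yields smoothness.
\<close>

lemma smooth_on_tensor:
  assumes "\<And>j. smooth_real (g j)"
  shows "smooth_on U (tensor g)"
proof -
  have cont: "continuous_on U (tensor g)" if "\<And>j. smooth_real (g j)" for g :: "'a \<Rightarrow> real \<Rightarrow> real"
  proof -
    have "continuous_on U (\<lambda>x. g j (x $ j))" for j
    proof (rule continuous_on_compose2[of UNIV "g j"])
      show "continuous_on UNIV (g j)"
        using smooth_real_DERIV[OF that] DERIV_isCont continuous_at_imp_continuous_on by blast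
    qed (auto intro: continuous_on_component continuous_on_id)
    then show ?thesis
      unfolding tensor_def by (rule continuous_on_prod)
  qed
  have "C_k_on k U (tensor g)" for k
    using assms
  proof (induction k arbitrary: g)
    case (Suc k)
    then have "C_k_on k U (tensor (g(i := deriv (g i))))" for i
      by (intro Suc.IH) (auto intro: smooth_real_deriv)
    then show ?case
      using Suc.prems by (auto simp: tensor_partial_deriv cont)
  qed (auto intro: cont)
  then show ?thesis by (simp add: smooth_on_def)
qed

lemma mi_deriv_tensor:
  assumes "\<And>j. smooth_real (g j)"
  shows "mi_deriv \<alpha> (tensor g) = tensor (\<lambda>j. (deriv ^^ (\<alpha> $ j)) (g j))"
proof -
  have pow: "(partial_deriv i ^^ n) (tensor h) = tensor (h(i := (deriv ^^ n) (h i)))"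
    if "\<And>j. smooth_real (h j)" for i n and h :: "'a \<Rightarrow> real \<Rightarrow> real"
  proof (induction n)
    case (Suc n)
    let ?h = "h(i := (deriv ^^ n) (h i))"
    have "(partial_deriv i ^^ Suc n) (tensor h) = partial_deriv i (tensor ?h)"
      unfolding funpow.simps comp_apply Suc ..
    also have "\<dots> = tensor (?h(i := deriv (?h i)))"
      using that by (intro tensor_partial_deriv(1)) (simp add: smooth_real_funpow_deriv)
    also have "?h(i := deriv (?h i)) = h(i := (deriv ^^ Suc n) (h i))"
      by auto
    finally show ?case .
  qed simp
  have "foldr (\<lambda>i. partial_deriv i ^^ (\<alpha> $ i)) xs (tensor g) =
      tensor (\<lambda>j. if j \<in> set xs then (deriv ^^ (\<alpha> $ j)) (g j) else g j)"
    if "distinct xs" for xs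
    using that
  proof (induction xs)
    case (Cons i xs)
    have "(partial_deriv i ^^ (\<alpha> $ i))
          (tensor (\<lambda>j. if j \<in> set xs then (deriv ^^ (\<alpha> $ j)) (g j) else g j)) =
        tensor ((\<lambda>j. if j \<in> set xs then (deriv ^^ (\<alpha> $ j)) (g j) else g j)(i := (deriv ^^ (\<alpha> $ i)) (g i)))"
      using Cons.prems assms by (subst pow) (auto intro: smooth_real_funpow_deriv)
    also have "\<dots> = tensor (\<lambda>j. if j \<in> set (i # xs) then (deriv ^^ (\<alpha> $ j)) (g j) else g j)"
      by (rule arg_cong[where f = tensor]) auto
    finally show ?case
      using Cons by simp
  qed simp
  from this[of "sorted_list_of_set UNIV"] show ?thesis
    by (simp add: mi_deriv_def)
qed

text \<open>
  The witness is the product of the functions \<open>(x\<^sub>i - y\<^sub>i)\<^bsup>\<alpha>\<^sub>i\<^esup> b (x\<^sub>i - y\<^sub>i)\<close>. A multi-index \<open>\<beta> \<noteq> \<alpha>\<close> of at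
  most the same order has \<open>\<beta>\<^sub>i < \<alpha>\<^sub>i\<close> for some \<open>i\<close>, and then the \<open>i\<close>-th factor of \<open>D\<^sup>\<beta> f y\<close> vanishes.
  Derivatives of higher order at \<open>y\<close> stay uncontrolled, as \<open>b\<close> need not be constant near \<open>0\<close>.
\<close>

lemma ex_smooth_with_leading_derivative:
  fixes y :: "real ^ 'd::{finite,linorder}"
  assumes "open V" "y \<in> V"
  obtains f where "f \<in> Cc_infinity UNIV" "closure {x. f x \<noteq> 0} \<subseteq> V"
    "mi_deriv \<alpha> f y \<noteq> 0"
    "\<And>\<beta>. mi_order \<beta> \<le> mi_order \<alpha> \<Longrightarrow> \<beta> \<noteq> \<alpha> \<Longrightarrow> mi_deriv \<beta> f y = 0"
proof -
  obtain e where e: "e > 0" "cball y e \<subseteq> V"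
    using assms open_contains_cball by blast
  \<comment> \<open>A cube of half-width \<open>\<delta>\<close> lies in the ball of radius \<open>e\<close>, by the \<open>\<ell>\<^sup>1\<close> bound on the norm.\<close>
  define \<delta> where "\<delta> = e / real CARD('d)"
  have "\<delta> > 0" using e by (simp add: \<delta>_def)
  then obtain b where b: "smooth_real b" "b 0 \<noteq> 0" "\<And>t. \<delta> < \<bar>t\<bar> \<Longrightarrow> b t = 0"
    by (rule ex_bump) blast
  define h where "h i = (\<lambda>t. t ^ (\<alpha> $ i) * b t)" for i
  define g where "g i = (\<lambda>t. h i (1 * t + (- (y $ i))))" for i
  have smooth_h: "smooth_real (h i)" for i
    unfolding h_def using b by (intro smooth_real_mult smooth_real_power smooth_real_id)
  have smooth_g: "smooth_real (g i)" for i
    unfolding g_def by (rule smooth_real_compose[OF smooth_h smooth_real_affine])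
  have g_deriv: "(deriv ^^ n) (g i) = (\<lambda>t. (deriv ^^ n) (h i) (t - y $ i))" for i n
  proof (induction n)
    case (Suc n)
    have "((\<lambda>t. (deriv ^^ n) (h i) (t - y $ i)) has_real_derivative
        deriv ((deriv ^^ n) (h i)) (t - y $ i)) (at t)" for t
      using DERIV_shift[of "(deriv ^^ n) (h i)" "deriv ((deriv ^^ n) (h i)) (t - y $ i)" t "- (y $ i)"]
        smooth_real_DERIV[OF smooth_real_funpow_deriv[OF smooth_h], of n i "t - y $ i"]
      by simp
    then show ?case
      using Suc by (auto simp: DERIV_imp_deriv)
  qed (simp add: g_def)
  have deriv_y: "mi_deriv \<beta> (tensor g) y = (\<Prod>i\<in>UNIV. (deriv ^^ (\<beta> $ i)) (h i) 0)" for \<beta>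
    using smooth_g by (simp add: mi_deriv_tensor g_deriv tensor_def)
  have "{x. tensor g x \<noteq> 0} \<subseteq> cball y e"
  proof
    fix x assume "x \<in> {x. tensor g x \<noteq> 0}"
    then have "b (x $ i - y $ i) \<noteq> 0" for i
      by (auto simp: tensor_def g_def h_def)
    then have "\<bar>(y - x) $ i\<bar> \<le> \<delta>" for i
      using b(3)[of "x $ i - y $ i"] by (force simp: abs_minus_commute)
    then have "(\<Sum>i\<in>UNIV. \<bar>(y - x) $ i\<bar>) \<le> real CARD('d) * \<delta>"
      by (rule sum_bounded_above)
    moreover have "real CARD('d) * \<delta> = e"
      by (simp add: \<delta>_def)
    ultimately show "x \<in> cball y e"
      using norm_le_l1_cart[of "y - x"] by (simp add: dist_norm)
  qed
  then have supp: "closure {x. tensor g x \<noteq> 0} \<subseteq> cball y e"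
    by (intro closure_minimal) auto
  then have "compact (closure {x. tensor g x \<noteq> 0})"
    unfolding compact_closure by (rule bounded_subset[OF bounded_cball order.trans[OF closure_subset]])
  then have "tensor g \<in> Cc_infinity UNIV"
    using smooth_on_tensor[OF smooth_g] by (simp add: Cc_infinity_def)
  moreover have "closure {x. tensor g x \<noteq> 0} \<subseteq> V"
    using supp e by blast
  moreover have "mi_deriv \<alpha> (tensor g) y \<noteq> 0"
    using funpow_deriv_monomial_times(2)[OF b(1,2)] by (simp add: deriv_y h_def)
  moreover have "mi_deriv \<beta> (tensor g) y = 0"
    if le_order: "mi_order \<beta> \<le> mi_order \<alpha>" and neq: "\<beta> \<noteq> \<alpha>" for \<beta>
  proof -
    have "\<exists>i. \<beta> $ i < \<alpha> $ i"
    proof (rule ccontr)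
      assume "\<nexists>i. \<beta> $ i < \<alpha> $ i"
      then have le: "\<alpha> $ i \<le> \<beta> $ i" for i by (meson not_le)
      obtain i where "\<alpha> $ i < \<beta> $ i"
        using neq le by (metis vec_eq_iff le_neq_implies_less)
      then have "mi_order \<alpha> < mi_order \<beta>"
        unfolding mi_order_def using le by (intro sum_strict_mono_ex1) auto
      with le_order show False by simp
    qed
    then obtain i where "\<beta> $ i < \<alpha> $ i" ..
    then have "(deriv ^^ (\<beta> $ i)) (h i) 0 = 0"
      using funpow_deriv_monomial_times(1)[OF b(1,2)] by (simp add: h_def)
    then show ?thesis
      unfolding deriv_y by (intro prod_zero) auto
  qed
  ultimately show thesis ..
qed

section \<open>Test functions\<close>

lemma Cc_infinityD:
  assumes "f \<in> Cc_infinity U"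
  shows "smooth_on U f" "compact (closure {x. f x \<noteq> 0})" "closure {x. f x \<noteq> 0} \<subseteq> U"
  using assms unfolding Cc_infinity_def by blast+

lemma Cc_infinity_mono:
  assumes "f \<in> Cc_infinity UNIV" "closure {x. f x \<noteq> 0} \<subseteq> U"
  shows "f \<in> Cc_infinity U"
  using assms smooth_on_subset[OF _ subset_UNIV] unfolding Cc_infinity_def by blast

lemma Cc_infinity_zero: "(\<lambda>_. 0) \<in> Cc_infinity U"
  by (simp add: Cc_infinity_def smooth_on_zero)

lemma Cc_infinity_add:
  assumes "open U" "f \<in> Cc_infinity U" "g \<in> Cc_infinity U"
  shows "(\<lambda>x. f x + g x) \<in> Cc_infinity U"
proof -
  let ?K = "closure {x. f x \<noteq> 0} \<union> closure {x. g x \<noteq> 0}"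
  have K: "compact ?K" "?K \<subseteq> U"
    using assms(2,3)[THEN Cc_infinityD(2)] assms(2,3)[THEN Cc_infinityD(3)]
    by (simp_all add: compact_Un)
  have "{x. f x + g x \<noteq> 0} \<subseteq> {x. f x \<noteq> 0} \<union> {x. g x \<noteq> 0}"
    by auto
  also have "\<dots> \<subseteq> ?K"
    by (intro Un_mono closure_subset)
  finally have "{x. f x + g x \<noteq> 0} \<subseteq> ?K" .
  then have sub: "closure {x. f x + g x \<noteq> 0} \<subseteq> ?K"
    by (rule closure_minimal[OF _ compact_imp_closed[OF K(1)]])
  then have "compact (closure {x. f x + g x \<noteq> 0})"
    unfolding compact_closure
    by (rule bounded_subset[OF compact_imp_bounded[OF K(1)] order.trans[OF closure_subset]])
  moreover have "smooth_on U (\<lambda>x. f x + g x)"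
    by (rule smooth_on_add[OF assms(1) assms(2,3)[THEN Cc_infinityD(1)]])
  ultimately show ?thesis
    using sub K(2) unfolding Cc_infinity_def by blast
qed

definition jet :: "(real ^ 'd::{finite,linorder} \<Rightarrow> real ^ 'n::finite) \<Rightarrow>
    nat ^ 'd::{finite,linorder} \<Rightarrow> real ^ 'd::{finite,linorder} \<Rightarrow> real ^ 'n" where
  "jet \<phi> \<alpha> x = (\<chi> j. mi_deriv \<alpha> (\<lambda>y. \<phi> y $ j) x)"

lemma jet_add:
  assumes "open U" "x \<in> U"
    "\<And>j. (\<lambda>x. \<phi> x $ j) \<in> Cc_infinity U" "\<And>j. (\<lambda>x. \<psi> x $ j) \<in> Cc_infinity U"
  shows "jet (\<lambda>x. \<phi> x + \<psi> x) \<alpha> x = jet \<phi> \<alpha> x + jet \<psi> \<alpha> x"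
proof -
  have "smooth_on U (\<lambda>x. \<phi> x $ j)" "smooth_on U (\<lambda>x. \<psi> x $ j)" for j
    by (rule Cc_infinityD(1)[OF assms(3)], rule Cc_infinityD(1)[OF assms(4)])
  from mi_deriv_add[OF assms(1,2) this] show ?thesis
    by (simp add: jet_def vec_eq_iff)
qed

text \<open>
  Take \<open>\<gamma>\<close> of maximal order with \<open>Q \<gamma> \<noteq> 0\<close>, and a function with leading derivative \<open>D\<^sup>\<gamma>\<close> at \<open>y\<close>. Only
  the term of \<open>\<gamma>\<close> survives in the sum: elsewhere the derivative vanishes, or the order is above that
  of \<open>\<gamma>\<close> and the coefficient does. Placing the function in a component \<open>j\<close> for which the \<open>j\<close>-th
  column of \<open>Q \<gamma>\<close> is nonzero makes this term nonzero.
\<close>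

lemma ex_test_function_not_annihilated:
  fixes Q :: "nat ^ 'd::{finite,linorder} \<Rightarrow> real ^ 'n::finite ^ 'm::finite"
    and y :: "real ^ 'd::{finite,linorder}"
  assumes "open V" "y \<in> V" "Q \<alpha> \<noteq> 0" "\<And>\<beta>. s < mi_order \<beta> \<Longrightarrow> Q \<beta> = 0"
  shows "\<exists>\<psi>. (\<forall>j. (\<lambda>x. \<psi> x $ j) \<in> Cc_infinity UNIV) \<and>
    (\<forall>j. closure {x. \<psi> x $ j \<noteq> 0} \<subseteq> V) \<and>
    (\<Sum>\<beta> | mi_order \<beta> \<le> s. Q \<beta> *v jet \<psi> \<beta> y) \<noteq> 0"
proof -
  define \<gamma> where "\<gamma> = arg_max mi_order (\<lambda>\<beta>. Q \<beta> \<noteq> 0)"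
  have bound: "\<And>\<beta>. Q \<beta> \<noteq> 0 \<Longrightarrow> mi_order \<beta> < Suc s"
    using assms(4) by (meson less_Suc_eq_le not_le)
  have \<gamma>: "Q \<gamma> \<noteq> 0" "\<And>\<beta>. Q \<beta> \<noteq> 0 \<Longrightarrow> mi_order \<beta> \<le> mi_order \<gamma>"
    using arg_max_nat_lemma[of "\<lambda>\<beta>. Q \<beta> \<noteq> 0" \<alpha> mi_order "Suc s"] assms(3) bound
    unfolding \<gamma>_def by blast+
  obtain l j where lj: "Q \<gamma> $ l $ j \<noteq> 0"
    using \<gamma>(1) by (metis vec_eq_iff zero_index)
  obtain f where f: "f \<in> Cc_infinity UNIV" "closure {x. f x \<noteq> 0} \<subseteq> V"
    "mi_deriv \<gamma> f y \<noteq> 0" "\<And>\<beta>. mi_order \<beta> \<le> mi_order \<gamma> \<Longrightarrow> \<beta> \<noteq> \<gamma> \<Longrightarrow> mi_deriv \<beta> f y = 0"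
    using ex_smooth_with_leading_derivative[OF assms(1,2)] by metis
  define \<psi> :: "real ^ 'd::{finite,linorder} \<Rightarrow> real ^ 'n" where "\<psi> x = axis j (f x)" for x
  have comp: "(\<lambda>x. \<psi> x $ i) = (if i = j then f else (\<lambda>_. 0))" for i
    by (auto simp: \<psi>_def axis_def)
  have jet: "jet \<psi> \<beta> y = axis j (mi_deriv \<beta> f y)" for \<beta>
    unfolding jet_def comp by (auto simp: vec_eq_iff axis_def mi_deriv_zero)
  have "(\<Sum>\<beta> | mi_order \<beta> \<le> s. Q \<beta> *v jet \<psi> \<beta> y) = (\<Sum>\<beta>\<in>{\<gamma>}. Q \<beta> *v jet \<psi> \<beta> y)"
  proof (rule sum.mono_neutral_right)
    show "\<forall>\<beta>\<in>{\<beta>. mi_order \<beta> \<le> s} - {\<gamma>}. Q \<beta> *v jet \<psi> \<beta> y = 0"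
    proof
      fix \<beta> assume "\<beta> \<in> {\<beta>. mi_order \<beta> \<le> s} - {\<gamma>}"
      then have "Q \<beta> = 0 \<or> mi_deriv \<beta> f y = 0"
        using f(4) \<gamma>(2) by blast
      moreover have "axis j 0 = (0 :: real ^ 'n)"
        by (simp add: axis_def vec_eq_iff)
      ultimately show "Q \<beta> *v jet \<psi> \<beta> y = 0"
        by (elim disjE) (simp_all only: jet matrix_vector_mult_0 matrix_vector_mult_0_right)
    qed
    show "{\<gamma>} \<subseteq> {\<beta>. mi_order \<beta> \<le> s}"
      using bound[OF \<gamma>(1)] by simp
  qed (rule finite_mi_order_le)
  moreover have "(Q \<gamma> *v jet \<psi> \<gamma> y) $ l = Q \<gamma> $ l $ j * mi_deriv \<gamma> f y"
    by (simp add: jet matrix_vector_mult_def axis_def if_distrib cong: if_cong)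
  ultimately have "(\<Sum>\<beta> | mi_order \<beta> \<le> s. Q \<beta> *v jet \<psi> \<beta> y) \<noteq> 0"
    using lj f(3) by (auto simp del: matrix_vector_mul_component)
  moreover have "(\<lambda>x. \<psi> x $ i) \<in> Cc_infinity UNIV" for i
    unfolding comp using f(1) Cc_infinity_zero[of UNIV] by (cases "i = j") simp_all
  moreover have "closure {x. \<psi> x $ i \<noteq> 0} \<subseteq> V" for i
    using f(2) fun_cong[OF comp[of i]] by (cases "i = j") simp_all
  ultimately show ?thesis
    by blast
qed

section \<open>Linear combinations of operators\<close>

lemma is_pdo_on_common_order:
  fixes L :: "nat \<Rightarrow> ('d::finite, 'n::finite, 'm::finite) pdo"
  assumes "\<And>i. i < r \<Longrightarrow> is_pdo_on U (L i)"
  shows "\<exists>s. \<forall>i<r. \<forall>\<alpha> x. s < mi_order \<alpha> \<longrightarrow> x \<in> U \<longrightarrow> L i \<alpha> x = 0"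
proof -
  have "\<forall>i\<in>{..<r}. \<exists>s. \<forall>\<alpha>. s < mi_order \<alpha> \<longrightarrow> (\<forall>x\<in>U. L i \<alpha> x = 0)"
    using assms by (auto simp: is_pdo_on_def)
  then obtain s where s: "\<forall>i\<in>{..<r}. \<forall>\<alpha>. s i < mi_order \<alpha> \<longrightarrow> (\<forall>x\<in>U. L i \<alpha> x = 0)"
    by (rule bchoice[THEN exE])
  have "s i \<le> sum s {..<r}" if "i < r" for i
    using that by (intro member_le_sum) auto
  then have "L i \<alpha> x = 0" if "i < r" "sum s {..<r} < mi_order \<alpha>" "x \<in> U" for i \<alpha> x
    using s that by (meson lessThan_iff order.strict_trans1)
  then show ?thesis by blast
qed

lemma sum_pdo_apply:
  fixes L :: "nat \<Rightarrow> ('d::{finite,linorder}, 'n::finite, 'm::finite) pdo"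
  assumes "\<And>i \<alpha>. i < r \<Longrightarrow> s < mi_order \<alpha> \<Longrightarrow> L i \<alpha> x = 0"
  shows "(\<Sum>i<r. c i *\<^sub>R pdo_apply (L i) \<phi> x) =
    (\<Sum>\<alpha> | mi_order \<alpha> \<le> s. (\<Sum>i<r. c i *\<^sub>R L i \<alpha> x) *v jet \<phi> \<alpha> x)"
proof -
  have "(\<Sum>i<r. c i *\<^sub>R pdo_apply (L i) \<phi> x) =
      (\<Sum>i<r. \<Sum>\<alpha> | mi_order \<alpha> \<le> s. (c i *\<^sub>R L i \<alpha> x) *v jet \<phi> \<alpha> x)"
    using assms
    by (intro sum.cong refl)
      (simp add: pdo_apply_eq[where s = s] jet_def scaleR_sum_right scaleR_matrix_vector_assoc)
  also have "\<dots> = (\<Sum>\<alpha> | mi_order \<alpha> \<le> s. \<Sum>i<r. (c i *\<^sub>R L i \<alpha> x) *v jet \<phi> \<alpha> x)"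
    by (rule sum.swap)
  also have "\<dots> = (\<Sum>\<alpha> | mi_order \<alpha> \<le> s. (\<Sum>i<r. c i *\<^sub>R L i \<alpha> x) *v jet \<phi> \<alpha> x)"
  proof -
    have "(\<Sum>i<r. A i *v v) = (\<Sum>i<r. A i) *v v" for A :: "nat \<Rightarrow> real ^ 'n ^ 'm" and v
      by (induction r) (simp_all add: matrix_vector_mult_add_rdistrib)
    then show ?thesis by simp
  qed
  finally show ?thesis .
qed

text \<open>
  The combined operator can be made visible at a new point without disturbing what is known on \<open>S\<close>:
  the correction \<open>\<psi>\<close> is supported in \<open>U - S\<close>, so all its derivatives vanish on \<open>S\<close>.
\<close>

lemma ex_test_function_detecting_combination:
  fixes L :: "nat \<Rightarrow> ('d::{finite,linorder}, 'n::finite, 'm::finite) pdo"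
  assumes "open U" "\<And>i. i < r \<Longrightarrow> is_pdo_on U (L i)"
    and "finite S" "S \<subseteq> U"
    and "x\<^sub>0 \<in> U" "(\<Sum>i<r. c i *\<^sub>R L i \<alpha> x\<^sub>0) \<noteq> 0"
    and \<phi>: "\<And>j. (\<lambda>x. \<phi> x $ j) \<in> Cc_infinity U"
  shows "\<exists>\<phi>' y. (\<forall>j. (\<lambda>x. \<phi>' x $ j) \<in> Cc_infinity U) \<and> y \<in> U \<and>
    (\<forall>i<r. \<forall>x\<in>S. pdo_apply (L i) \<phi>' x = pdo_apply (L i) \<phi> x) \<and>
    (\<Sum>i<r. c i *\<^sub>R pdo_apply (L i) \<phi>' y) \<noteq> 0"
proof -
  obtain s where "\<forall>i<r. \<forall>\<alpha> x. s < mi_order \<alpha> \<longrightarrow> x \<in> U \<longrightarrow> L i \<alpha> x = 0"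
    using is_pdo_on_common_order[of r U L] assms(2) by blast
  then have s: "L i \<alpha> x = 0" if "i < r" "s < mi_order \<alpha>" "x \<in> U" for i \<alpha> x
    using that by blast
  define Q where "Q x \<beta> = (\<Sum>i<r. c i *\<^sub>R L i \<beta> x)" for x \<beta>
  \<comment> \<open>A nonempty open subset of \<open>\<real>\<^sup>d\<close> is infinite, so \<open>Q\<close> has a nonzero coefficient off \<open>S\<close> too.\<close>
  have "continuous_on U (\<lambda>x. Q x \<alpha>)"
    unfolding Q_def using assms(2) by (intro continuous_intros) (auto simp: is_pdo_on_def)
  then have "open (U \<inter> (\<lambda>x. Q x \<alpha>) -` (- {0}))"
    using assms(1) by (intro continuous_open_preimage) auto
  moreover have "x\<^sub>0 \<in> U \<inter> (\<lambda>x. Q x \<alpha>) -` (- {0})"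
    using assms(5,6) by (simp add: Q_def)
  ultimately have "infinite (U \<inter> (\<lambda>x. Q x \<alpha>) -` (- {0}))"
    using finite_imp_not_open by blast
  then have "\<not> U \<inter> (\<lambda>x. Q x \<alpha>) -` (- {0}) \<subseteq> S"
    using assms(3) finite_subset by blast
  then obtain y where y: "y \<in> U" "Q y \<alpha> \<noteq> 0" "y \<notin> S"
    by blast
  have "open (U - S)" "y \<in> U - S"
    using assms(1,3) y by (simp_all add: open_Diff finite_imp_closed)
  moreover have "Q y \<beta> = 0" if "s < mi_order \<beta>" for \<beta>
    unfolding Q_def using s[OF _ that y(1)] by (intro sum.neutral) simp
  ultimately obtain \<psi> where "\<forall>j. (\<lambda>x. \<psi> x $ j) \<in> Cc_infinity UNIV"
      "\<forall>j. closure {x. \<psi> x $ j \<noteq> 0} \<subseteq> U - S"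
      and \<psi>_y: "(\<Sum>\<beta> | mi_order \<beta> \<le> s. Q y \<beta> *v jet \<psi> \<beta> y) \<noteq> 0"
    using ex_test_function_not_annihilated[of "U - S" y "Q y" \<alpha> s] y(2) by blast
  then have \<psi>: "(\<lambda>x. \<psi> x $ j) \<in> Cc_infinity UNIV" "closure {x. \<psi> x $ j \<noteq> 0} \<subseteq> U - S" for j
    by simp_all
  have \<psi>U: "(\<lambda>x. \<psi> x $ j) \<in> Cc_infinity U" for j
    using \<psi>(2)[of j] by (intro Cc_infinity_mono[OF \<psi>(1)]) blast
  show ?thesis
  proof (cases "(\<Sum>i<r. c i *\<^sub>R pdo_apply (L i) \<phi> y) = 0")
    case False
    then show ?thesis using \<phi> y(1) by blast
  next
    case True
    let ?\<phi> = "\<lambda>x. \<phi> x + \<psi> x"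
    have jet_sum: "jet ?\<phi> \<beta> x = jet \<phi> \<beta> x + jet \<psi> \<beta> x" if "x \<in> U" for \<beta> x
      by (rule jet_add[OF assms(1) that \<phi> \<psi>U])
    have "jet ?\<phi> \<beta> x = jet \<phi> \<beta> x" if "x \<in> S" for \<beta> x
    proof -
      have "mi_deriv \<beta> (\<lambda>x. \<psi> x $ j) x = 0" for j
        using that \<psi>(2)[of j] by (intro mi_deriv_outside_support) blast
      then have "jet \<psi> \<beta> x = 0"
        by (simp add: jet_def vec_eq_iff)
      then show ?thesis
        using jet_sum that assms(4) by auto
    qed
    then have "pdo_apply (L i) ?\<phi> x = pdo_apply (L i) \<phi> x" if "x \<in> S" for i x
      using that unfolding pdo_apply_def jet_def[symmetric] by simp
    moreover have "(\<Sum>i<r. c i *\<^sub>R pdo_apply (L i) ?\<phi> y) \<noteq> 0"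
    proof -
      have apply_y: "(\<Sum>i<r. c i *\<^sub>R pdo_apply (L i) \<eta> y) =
          (\<Sum>\<beta> | mi_order \<beta> \<le> s. Q y \<beta> *v jet \<eta> \<beta> y)" for \<eta>
        unfolding Q_def by (rule sum_pdo_apply) (rule s[OF _ _ y(1)])
      have "(\<Sum>i<r. c i *\<^sub>R pdo_apply (L i) ?\<phi> y) =
          (\<Sum>\<beta> | mi_order \<beta> \<le> s. Q y \<beta> *v jet \<phi> \<beta> y) +
          (\<Sum>\<beta> | mi_order \<beta> \<le> s. Q y \<beta> *v jet \<psi> \<beta> y)"
        unfolding apply_y jet_sum[OF y(1)] matrix_vector_right_distrib sum.distrib ..
      then show ?thesis
        using True \<psi>_y unfolding apply_y by simp
    qed
    moreover have "(\<lambda>x. ?\<phi> x $ j) \<in> Cc_infinity U" for j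
      unfolding vector_add_component by (rule Cc_infinity_add[OF assms(1) \<phi> \<psi>U])
    ultimately show ?thesis
      using y(1) by (intro exI[of _ ?\<phi>] exI[of _ y] conjI) simp_all
  qed
qed

text \<open>
  Linear independence of the restrictions of \<open>v 0, \<dots>, v (r - 1)\<close> to \<open>S\<close>.
\<close>

definition separates_at ::
    "(real ^ 'd::finite) set \<Rightarrow> nat \<Rightarrow> (nat \<Rightarrow> real ^ 'd \<Rightarrow> real ^ 'm::finite) \<Rightarrow> bool" where
  "separates_at S r v \<longleftrightarrow>
     (\<forall>c. (\<forall>x\<in>S. (\<Sum>i<r. c i *\<^sub>R v i x) = 0) \<longrightarrow> (\<forall>i<r. c i = 0))"

lemma separates_atD:
  assumes "separates_at S r v" "\<And>x. x \<in> S \<Longrightarrow> (\<Sum>i<r. c i *\<^sub>R v i x) = 0" "i < r"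
  shows "c i = 0"
  using assms unfolding separates_at_def by blast

text \<open>
  By independence of the first \<open>r\<close> functions, \<open>c r \<noteq> 0\<close> for a dependence \<open>c\<close> of all \<open>r + 1\<close> on \<open>S\<close>. If
  \<open>d\<close> is another one, subtracting the multiple of \<open>c\<close> that cancels the last entry leaves a dependence
  of the first \<open>r\<close>; so \<open>d\<close> is a multiple of \<open>c\<close>, which the value at \<open>y\<close> forces to be \<open>0\<close>.
\<close>

lemma separates_at_insert:
  assumes sep: "separates_at S r v"
    and c: "\<And>x. x \<in> S \<Longrightarrow> (\<Sum>i<Suc r. c i *\<^sub>R v i x) = 0" "k < Suc r" "c k \<noteq> 0"
    and w: "\<And>i x. i < Suc r \<Longrightarrow> x \<in> S \<Longrightarrow> w i x = v i x"
    and y: "(\<Sum>i<Suc r. c i *\<^sub>R w i y) \<noteq> 0"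
  shows "separates_at (insert y S) (Suc r) w"
proof -
  have "c r \<noteq> 0"
  proof
    assume "c r = 0"
    then have "c i = 0" if "i < r" for i
      using that by (intro separates_atD[OF sep]) (use c(1) in simp)
    with c(2,3) \<open>c r = 0\<close> show False by (auto simp: less_Suc_eq)
  qed
  have "d i = 0" if d: "\<forall>x\<in>insert y S. (\<Sum>i<Suc r. d i *\<^sub>R w i x) = 0" and "i < Suc r" for d i
  proof -
    define q where "q = d r / c r"
    have qr: "d r - q * c r = 0"
      using \<open>c r \<noteq> 0\<close> by (simp add: q_def)
    have "d i - q * c i = 0" if "i < r" for i
    proof (rule separates_atD[OF sep _ that, of "\<lambda>i. d i - q * c i"])
      fix x assume x: "x \<in> S"
      have "(\<Sum>i<Suc r. (d i - q * c i) *\<^sub>R v i x) =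
          (\<Sum>i<Suc r. d i *\<^sub>R v i x) - q *\<^sub>R (\<Sum>i<Suc r. c i *\<^sub>R v i x)"
        by (simp only: scaleR_diff_left sum_subtractf scaleR_sum_right scaleR_scaleR)
      also have "(\<Sum>i<Suc r. d i *\<^sub>R v i x) = (\<Sum>i<Suc r. d i *\<^sub>R w i x)"
        using w x by (intro sum.cong) simp_all
      also have "\<dots> = 0"
        using d x by blast
      finally show "(\<Sum>i<r. (d i - q * c i) *\<^sub>R v i x) = 0"
        using qr c(1)[OF x] by simp
    qed
    with qr have eq: "d i = q * c i" if "i < Suc r" for i
      using that by (auto simp: less_Suc_eq)
    have "q *\<^sub>R (\<Sum>i<Suc r. c i *\<^sub>R w i y) = (\<Sum>i<Suc r. d i *\<^sub>R w i y)"
      unfolding scaleR_sum_right by (intro sum.cong) (simp_all add: eq)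
    also have "\<dots> = 0"
      using d by blast
    finally have "q = 0"
      using y by simp
    with eq[OF \<open>i < Suc r\<close>] show ?thesis by simp
  qed
  then show ?thesis
    unfolding separates_at_def by blast
qed

lemma lin_dep_pdos_on_Suc:
  assumes "lin_dep_pdos_on U r L"
  shows "lin_dep_pdos_on U (Suc r) L"
proof -
  obtain c k where c: "k < r" "c k \<noteq> 0" "\<forall>\<alpha>. \<forall>x\<in>U. (\<Sum>i<r. c i *\<^sub>R L i \<alpha> x) = 0"
    using assms unfolding lin_dep_pdos_on_def by blast
  let ?c = "c(r := 0)"
  have "(\<Sum>i<Suc r. ?c i *\<^sub>R L i \<alpha> x) = (\<Sum>i<r. c i *\<^sub>R L i \<alpha> x)" for \<alpha> x
    by simp
  moreover have "k < Suc r \<and> ?c k \<noteq> 0"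
    using c by simp
  ultimately show ?thesis
    using c(3) unfolding lin_dep_pdos_on_def by (intro exI[of _ ?c] conjI exI[of _ k]) simp_all
qed

text \<open>
  Either the test function of the induction hypothesis still separates with one operator more, or
  one correction at one new point repairs the only dependence there is.
\<close>

lemma ex_separating_test_function:
  fixes L :: "nat \<Rightarrow> ('d::{finite,linorder}, 'n::finite, 'm::finite) pdo"
  assumes "open U" "\<And>i. i < r \<Longrightarrow> is_pdo_on U (L i)" "\<not> lin_dep_pdos_on U r L"
  shows "\<exists>\<phi> S. (\<forall>j. (\<lambda>x. \<phi> x $ j) \<in> Cc_infinity U) \<and> finite S \<and> S \<subseteq> U \<and>
    separates_at S r (\<lambda>i. pdo_apply (L i) \<phi>)"
  using assms(2,3)
proof (induction r)
  case 0
  show ?case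
    by (intro exI[of _ "\<lambda>_. 0"] exI[of _ "{}"]) (simp add: Cc_infinity_zero separates_at_def)
next
  case (Suc r)
  have "\<not> lin_dep_pdos_on U r L"
    using Suc.prems(2) lin_dep_pdos_on_Suc by blast
  moreover have "is_pdo_on U (L i)" if "i < r" for i
    using that by (intro Suc.prems(1)) simp
  ultimately obtain \<phi> S where \<phi>: "\<forall>j. (\<lambda>x. \<phi> x $ j) \<in> Cc_infinity U"
    and S: "finite S" "S \<subseteq> U" and sep: "separates_at S r (\<lambda>i. pdo_apply (L i) \<phi>)"
    using Suc.IH by blast
  show ?case
  proof (cases "separates_at S (Suc r) (\<lambda>i. pdo_apply (L i) \<phi>)")
    case True
    then show ?thesis using \<phi> S by blast
  next
    case False
    then obtain c k where c: "\<And>x. x \<in> S \<Longrightarrow> (\<Sum>i<Suc r. c i *\<^sub>R pdo_apply (L i) \<phi> x) = 0"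
        "k < Suc r" "c k \<noteq> 0"
      unfolding separates_at_def by blast
    obtain \<alpha> x\<^sub>0 where x\<^sub>0: "x\<^sub>0 \<in> U" "(\<Sum>i<Suc r. c i *\<^sub>R L i \<alpha> x\<^sub>0) \<noteq> 0"
      using Suc.prems(2) c(2,3) unfolding lin_dep_pdos_on_def by blast
    obtain \<phi>' y where \<phi>': "\<forall>j. (\<lambda>x. \<phi>' x $ j) \<in> Cc_infinity U" and y: "y \<in> U"
      and on_S: "\<forall>i<Suc r. \<forall>x\<in>S. pdo_apply (L i) \<phi>' x = pdo_apply (L i) \<phi> x"
      and at_y: "(\<Sum>i<Suc r. c i *\<^sub>R pdo_apply (L i) \<phi>' y) \<noteq> 0"
      using ex_test_function_detecting_combination[OF assms(1) Suc.prems(1) S x\<^sub>0, of \<phi>] \<phi> by blast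
    have "separates_at (insert y S) (Suc r) (\<lambda>i. pdo_apply (L i) \<phi>')"
      using on_S
      by (intro separates_at_insert[of S r "\<lambda>i. pdo_apply (L i) \<phi>" c k] sep c at_y) simp_all
    then show ?thesis
      using \<phi>' y S by (intro exI[of _ \<phi>'] exI[of _ "insert y S"]) simp
  qed
qed

theorem theorem3:
  fixes U :: "(real ^ 'd::{finite,linorder}) set"
    and L :: "nat \<Rightarrow> ('d, 'n::finite, 'm::finite) pdo"
    and r :: nat
  assumes "open U"
    and "r \<ge> 1"
    and "\<And>i. i < r \<Longrightarrow> is_pdo_on U (L i)"
  shows "(\<forall>\<phi> :: real ^ 'd::{finite,linorder} \<Rightarrow> real ^ 'n.
            (\<forall>j. (\<lambda>x. \<phi> x $ j) \<in> Cc_infinity U) \<longrightarrow>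
              lin_dep_functions_on U r (\<lambda>i. pdo_apply (L i) \<phi>))
         \<longleftrightarrow> lin_dep_pdos_on U r L"
proof
  assume dep: "\<forall>\<phi> :: real ^ 'd::{finite,linorder} \<Rightarrow> real ^ 'n. (\<forall>j. (\<lambda>x. \<phi> x $ j) \<in> Cc_infinity U) \<longrightarrow>
    lin_dep_functions_on U r (\<lambda>i. pdo_apply (L i) \<phi>)"
  show "lin_dep_pdos_on U r L"
  proof (rule ccontr)
    assume "\<not> lin_dep_pdos_on U r L"
    then obtain \<phi> S where \<phi>: "\<forall>j. (\<lambda>x. \<phi> x $ j) \<in> Cc_infinity U" and "S \<subseteq> U"
      and sep: "separates_at S r (\<lambda>i. pdo_apply (L i) \<phi>)"
      using ex_separating_test_function[OF assms(1), of r L] assms(3) by blast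
    obtain c k where c: "k < r" "c k \<noteq> 0"
        "\<And>x. x \<in> U \<Longrightarrow> (\<Sum>i<r. c i *\<^sub>R pdo_apply (L i) \<phi> x) = 0"
      using dep \<phi> unfolding lin_dep_functions_on_def by blast
    have "c k = 0"
      by (rule separates_atD[OF sep _ c(1)]) (use c(3) \<open>S \<subseteq> U\<close> in blast)
    with c(2) show False ..
  qed
next
  assume "lin_dep_pdos_on U r L"
  then obtain c where c: "\<exists>i<r. c i \<noteq> 0" "\<forall>\<alpha>. \<forall>x\<in>U. (\<Sum>i<r. c i *\<^sub>R L i \<alpha> x) = 0"
    unfolding lin_dep_pdos_on_def by blast
  obtain s where "\<forall>i<r. \<forall>\<alpha> x. s < mi_order \<alpha> \<longrightarrow> x \<in> U \<longrightarrow> L i \<alpha> x = 0"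
    using is_pdo_on_common_order[of r U L] assms(3) by blast
  then have s: "L i \<alpha> x = 0" if "i < r" "s < mi_order \<alpha>" "x \<in> U" for i \<alpha> x
    using that by blast
  have "(\<Sum>i<r. c i *\<^sub>R pdo_apply (L i) \<phi> x) = 0" if "x \<in> U" for \<phi> x
    using s c(2) that by (subst sum_pdo_apply[where s = s]) auto
  then show "\<forall>\<phi> :: real ^ 'd::{finite,linorder} \<Rightarrow> real ^ 'n. (\<forall>j. (\<lambda>x. \<phi> x $ j) \<in> Cc_infinity U) \<longrightarrow>
      lin_dep_functions_on U r (\<lambda>i. pdo_apply (L i) \<phi>)"
    using c(1) unfolding lin_dep_functions_on_def by blast
qed

end
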